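(* Let $n \geq 4$ and let $P_n$ be the path on $n$ vertices. Then $\chi_s(S(P_n)) = 4$.
   Context: All graphs are finite, simple and undirected. A star coloring of a graph $G$ is a proper vertex coloring of $G$ in which every path on four vertices uses at least three distinct colors. The star chromatic number $\chi_s(G)$ is the least number of colors in a star coloring of $G$. The splitting graph $S(G)$ of a graph $G$ is obtained from $G$ by adding, for each vertex $v$ of $G$, a new vertex $v'$ whose neighborhood is $N(v')=N(v)$, the neighborhood of $v$ in $G$ (the new vertices are pairwise nonadjacent). *)

theory Defs
  imports Main
begin

record 'a sgraph =
  verts :: "'a set"
  edges :: "'a set set"

definition simple_graph :: "'a sgraph \<Rightarrow> bool" where
  "simple_graph G \<longleftrightarrow>
     finite (verts G) \<and> (\<forall>e\<in>edges G. e \<subseteq> verts G \<and> card e = 2)"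

definition neighborhood :: "'a sgraph \<Rightarrow> 'a \<Rightarrow> 'a set" where
  "neighborhood G v = {u \<in> verts G. {v, u} \<in> edges G}"

definition proper_coloring :: "'a sgraph \<Rightarrow> ('a \<Rightarrow> nat) \<Rightarrow> bool" where
  "proper_coloring G c \<longleftrightarrow>
     (\<forall>u\<in>verts G. \<forall>v\<in>verts G. {u, v} \<in> edges G \<longrightarrow> c u \<noteq> c v)"

(* The four-vertex paths are subgraphs, not necessarily induced ones. *)
definition star_coloring :: "'a sgraph \<Rightarrow> ('a \<Rightarrow> nat) \<Rightarrow> bool" where
  "star_coloring G c \<longleftrightarrow> proper_coloring G c \<and>
     (\<forall>p. set p \<subseteq> verts G \<and> length p = 4 \<and> distinct p \<and>
          (\<forall>i<3. {p ! i, p ! Suc i} \<in> edges G)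
        \<longrightarrow> card (c ` set p) \<ge> 3)"

definition star_chromatic_number :: "'a sgraph \<Rightarrow> nat" where
  "star_chromatic_number G =
     (LEAST k. \<exists>c. star_coloring G c \<and> card (c ` verts G) = k)"

(* Inl v is the original vertex v, and Inr v is its new copy v'. *)
definition splitting_graph :: "'a sgraph \<Rightarrow> ('a + 'a) sgraph" where
  "splitting_graph G =
     \<lparr> verts = Inl ` verts G \<union> Inr ` verts G,
       edges = (\<lambda>e. Inl ` e) ` edges G \<union>
               {{Inr v, Inl u} | u v. v \<in> verts G \<and> u \<in> neighborhood G v} \<rparr>"

definition path_graph :: "nat \<Rightarrow> nat sgraph" where
  "path_graph n = \<lparr> verts = {1..n}, edges = {{i, Suc i} | i. 1 \<le> i \<and> i < n} \<rparr>"

lemma simple_graph_path_graph: "simple_graph (path_graph n)"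
  by (auto simp: simple_graph_def path_graph_def)

lemma simple_graph_splitting_graph:
  assumes "simple_graph G"
  shows "simple_graph (splitting_graph G)"
  using assms
  by (auto simp: simple_graph_def splitting_graph_def neighborhood_def card_image)

lemma neighborhood_splitting_graph_new:
  assumes "v \<in> verts G"
  shows "neighborhood (splitting_graph G) (Inr v) = Inl ` neighborhood G v"
  using assms
  by (auto simp: splitting_graph_def neighborhood_def doubleton_eq_iff)

end

theory Submission
  imports Defs
begin

text \<open>
  Four colors suffice: color the original path cyclically with 0, 1, 2 and every copy with 3.
  On a bicolored path of four vertices the vertices at distance two have equal colors; two original
  vertices with a common neighbor have different colors, so both such pairs would consist of copies,
  but copies are pairwise nonadjacent.  Three colors already fail on the vertices
  \<open>1, 2, 3, 4, 2', 3'\<close>.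
\<close>

text \<open>Building vertex membership into the relation lets star colorings be stated through
  adjacency alone, with no side conditions on vertices.\<close>

definition adjacent :: "'a sgraph \<Rightarrow> 'a \<Rightarrow> 'a \<Rightarrow> bool" where
  "adjacent G u v \<longleftrightarrow> u \<in> verts G \<and> v \<in> verts G \<and> {u, v} \<in> edges G"

text \<open>In a proper coloring consecutive vertices of a path differ, so a path on four vertices
  has only two colors exactly when these alternate. The cardinality condition thus becomes a pair of
  equations between colors, and the list \<open>p\<close> becomes four named vertices.\<close>

lemma star_coloring_iff:
  "star_coloring G c \<longleftrightarrow>
     (\<forall>u v. adjacent G u v \<longrightarrow> c u \<noteq> c v) \<and>
     (\<forall>w x y z. adjacent G w x \<and> adjacent G x y \<and> adjacent G y z \<and> distinct [w, x, y, z]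
        \<longrightarrow> \<not> (c w = c y \<and> c x = c z))"
  (is "_ \<longleftrightarrow> ?proper \<and> ?star")
proof
  assume star: "star_coloring G c"
  have ?proper
    using star by (auto simp: star_coloring_def proper_coloring_def adjacent_def)
  moreover have ?star
  proof (intro allI impI notI)
    fix w x y z
    assume path: "adjacent G w x \<and> adjacent G x y \<and> adjacent G y z \<and> distinct [w, x, y, z]"
      and eq: "c w = c y \<and> c x = c z"
    have "card (c ` set [w, x, y, z]) \<ge> 3"
      using star path unfolding star_coloring_def
      by (elim conjE allE[of _ "[w, x, y, z]"])
        (auto simp: adjacent_def less_Suc_eq numeral_eq_Suc)
    moreover have "c ` set [w, x, y, z] = {c y, c z}"
      using eq by auto
    ultimately have "card {c y, c z} \<ge> 3"
      by simp
    then show False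
      by (simp add: card_insert_if split: if_splits)
  qed
  ultimately show "?proper \<and> ?star" ..
next
  assume *: "?proper \<and> ?star"
  have "card (c ` set p) \<ge> 3"
    if p: "set p \<subseteq> verts G" "length p = 4" "distinct p"
      "\<forall>i<3. {p ! i, p ! Suc i} \<in> edges G" for p
  proof -
    obtain w x y z where pe: "p = [w, x, y, z]"
      using p(2) by (auto simp: numeral_eq_Suc length_Suc_conv)
    have adj: "adjacent G w x" "adjacent G x y" "adjacent G y z"
      using p(1) spec[OF p(4), of 0] spec[OF p(4), of 1] spec[OF p(4), of 2]
      by (auto simp: pe adjacent_def numeral_eq_Suc)
    moreover have "\<not> (c w = c y \<and> c x = c z)"
      using * adj p(3) pe by blast
    moreover have "c w \<noteq> c x" "c x \<noteq> c y" "c y \<noteq> c z"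
      using * adj by auto
    ultimately show ?thesis
      by (auto simp: pe card_insert_if)
  qed
  with * show "star_coloring G c"
    by (auto simp: star_coloring_def proper_coloring_def adjacent_def)
qed

lemma adjacent_splitting_path [simp]:
  "adjacent (splitting_graph (path_graph n)) (Inl i) (Inl j) \<longleftrightarrow>
     i \<in> {1..n} \<and> j \<in> {1..n} \<and> (j = Suc i \<or> i = Suc j)"
  "adjacent (splitting_graph (path_graph n)) (Inl i) (Inr j) \<longleftrightarrow>
     i \<in> {1..n} \<and> j \<in> {1..n} \<and> (j = Suc i \<or> i = Suc j)"
  "adjacent (splitting_graph (path_graph n)) (Inr i) (Inl j) \<longleftrightarrow>
     i \<in> {1..n} \<and> j \<in> {1..n} \<and> (j = Suc i \<or> i = Suc j)"
  "\<not> adjacent (splitting_graph (path_graph n)) (Inr i) (Inr j)"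
proof -
  have Inl_doubleton: "{Inl a, Inl b} = Inl ` e \<longleftrightarrow> e = {a, b}" for a b :: nat and e
    using inj_image_eq_iff[OF inj_Inl, of "{a, b}" e] by auto
  \<comment> \<open>This keeps the two families of edges apart: an edge at a copy is never the image
    of an edge of the original path.\<close>
  have Inr_notin: "Inr a \<in> f \<Longrightarrow> f \<noteq> Inl ` e" for a :: nat and f e
    by auto
  note defs = adjacent_def splitting_graph_def path_graph_def neighborhood_def
  show "adjacent (splitting_graph (path_graph n)) (Inl i) (Inl j) \<longleftrightarrow>
     i \<in> {1..n} \<and> j \<in> {1..n} \<and> (j = Suc i \<or> i = Suc j)"
    by (auto simp: defs doubleton_eq_iff image_iff Inl_doubleton)
  show "adjacent (splitting_graph (path_graph n)) (Inl i) (Inr j) \<longleftrightarrow>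
     i \<in> {1..n} \<and> j \<in> {1..n} \<and> (j = Suc i \<or> i = Suc j)"
    by (auto simp: defs doubleton_eq_iff image_iff Inr_notin)
  show "adjacent (splitting_graph (path_graph n)) (Inr i) (Inl j) \<longleftrightarrow>
     i \<in> {1..n} \<and> j \<in> {1..n} \<and> (j = Suc i \<or> i = Suc j)"
    by (auto simp: defs doubleton_eq_iff image_iff Inr_notin)
  show "\<not> adjacent (splitting_graph (path_graph n)) (Inr i) (Inr j)"
    by (auto simp: defs doubleton_eq_iff image_iff Inr_notin)
qed

definition splitting_path_coloring :: "nat + nat \<Rightarrow> nat" where
  "splitting_path_coloring v = (case v of Inl i \<Rightarrow> i mod 3 | Inr i \<Rightarrow> 3)"

lemma splitting_path_coloring_simps [simp]:
  "splitting_path_coloring (Inl i) = i mod 3"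
  "splitting_path_coloring (Inr i) = 3"
  by (simp_all add: splitting_path_coloring_def)

lemma star_coloring_splitting_path:
  "star_coloring (splitting_graph (path_graph n)) splitting_path_coloring"
proof -
  let ?adj = "adjacent (splitting_graph (path_graph n))" and ?c = splitting_path_coloring
  have mod3: "i mod 3 \<noteq> 3" "3 \<noteq> i mod 3" for i :: nat
    using mod_less_divisor[of 3 i] by linarith+
  \<comment> \<open>Distances one and two are both nonzero modulo 3: the first makes the coloring
    proper on the original path, the second separates the two path neighbors of a vertex.\<close>
  have mod3_Suc: "Suc i mod 3 \<noteq> i mod 3" "Suc (Suc i) mod 3 \<noteq> i mod 3" for i :: nat
    by presburger+
  have proper: "?c u \<noteq> ?c v" if "?adj u v" for u v
    using that by (cases u; cases v) (auto simp: mod3 mod3_Suc mod3_Suc[symmetric])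
  have copies: "u \<in> range Inr \<and> v \<in> range Inr"
    if "?adj u x" "?adj x v" "u \<noteq> v" "?c u = ?c v" for u x v
    using that by (cases u; cases v; cases x) (auto simp: mod3 mod3_Suc mod3_Suc[symmetric])
  have "\<not> (?c w = ?c y \<and> ?c x = ?c z)"
    if "?adj w x" "?adj x y" "?adj y z" "distinct [w, x, y, z]" for w x y z
    \<comment> \<open>Both equations together would make \<open>x\<close> and \<open>y\<close>
      adjacent copies.\<close>
    using copies[of w x y] copies[of x y z] that by auto
  with proper show ?thesis
    unfolding star_coloring_iff by blast
qed

text \<open>The star chromatic number counts the colors that actually occur, so each of the four
  must be attained: the vertices 1, 2, 3 give the three residues and any copy gives 3.\<close>

lemma splitting_path_coloring_image:
  assumes "n \<ge> 3"
  shows "splitting_path_coloring ` verts (splitting_graph (path_graph n)) = {0, 1, 2, 3}"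
proof
  show "splitting_path_coloring ` verts (splitting_graph (path_graph n)) \<subseteq> {0, 1, 2, 3}"
    by (auto simp: splitting_graph_def path_graph_def)
  have "Inl 1 \<in> verts (splitting_graph (path_graph n))"
    "Inl 2 \<in> verts (splitting_graph (path_graph n))"
    "Inl 3 \<in> verts (splitting_graph (path_graph n))"
    "Inr 1 \<in> verts (splitting_graph (path_graph n))"
    using assms by (auto simp: splitting_graph_def path_graph_def)
  from this[THEN imageI, of splitting_path_coloring]
  show "{0, 1, 2, 3} \<subseteq> splitting_path_coloring ` verts (splitting_graph (path_graph n))"
    by simp
qed

text \<open>With at most three colors, original vertices at distance two among 1, 2, 3, 4 must
  differ in color. Then 1, 2, 3 use all three colors and properness fixes the rest: 4 is colored
  like 1, and 2' and 3' like 2 and 3. This makes the path 2', 3, 2, 3' bicolored.\<close>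

lemma card_ge_4_if_star_coloring:
  assumes "n \<ge> 4" and star: "star_coloring (splitting_graph (path_graph n)) c"
  shows "card (c ` verts (splitting_graph (path_graph n))) \<ge> 4"
proof (rule ccontr)
  let ?V = "verts (splitting_graph (path_graph n))"
  assume less: "\<not> card (c ` ?V) \<ge> 4"
  have "finite (c ` ?V)"
    by (simp add: splitting_graph_def path_graph_def)
  have three: "\<not> distinct [c s, c t, c u, c v]" if "{s, t, u, v} \<subseteq> ?V" for s t u v
  proof
    assume "distinct [c s, c t, c u, c v]"
    then have "card {c s, c t, c u, c v} = 4"
      by simp
    moreover have "{c s, c t, c u, c v} \<subseteq> c ` ?V"
      using that by auto
    ultimately show False
      using card_mono[OF \<open>finite (c ` ?V)\<close>] less by metis
  qed
  define a1 a2 a3 a4 b2 b3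
    where "a1 = c (Inl 1)" and "a2 = c (Inl 2)" and "a3 = c (Inl 3)" and "a4 = c (Inl 4)"
      and "b2 = c (Inr 2)" and "b3 = c (Inr 3)"
  note defs = a1_def a2_def a3_def a4_def b2_def b3_def
  have V: "Inl i \<in> ?V" "Inr i \<in> ?V" if "i \<in> {1..4}" for i
    using that assms(1) by (auto simp: splitting_graph_def path_graph_def)
  have proper: "a1 \<noteq> a2" "a2 \<noteq> a3" "a3 \<noteq> a4" "b2 \<noteq> a1" "b2 \<noteq> a3" "b3 \<noteq> a2" "b3 \<noteq> a4"
    unfolding defs using star assms(1) by (auto simp: star_coloring_iff)
  have path: "\<not> (c w = c y \<and> c x = c z)"
    if "adjacent (splitting_graph (path_graph n)) w x"
      "adjacent (splitting_graph (path_graph n)) x y"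
      "adjacent (splitting_graph (path_graph n)) y z" "distinct [w, x, y, z]" for w x y z
    using star that unfolding star_coloring_iff by blast
  \<comment> \<open>The list is closed under the reflection that sends i to 5 - i: it swaps the
    second fact with the third and the fourth with the fifth, and fixes the other two.\<close>
  have paths:
    "\<not> (a1 = a3 \<and> a2 = a4)" "\<not> (a1 = a3 \<and> a2 = b2)" "\<not> (a4 = a2 \<and> a3 = b3)"
    "\<not> (a1 = a3 \<and> b2 = a4)" "\<not> (a1 = b3 \<and> a2 = a4)" "\<not> (b2 = a2 \<and> a3 = b3)"
    unfolding defs
    using path[of "Inl 1" "Inl 2" "Inl 3" "Inl 4"] path[of "Inl 1" "Inl 2" "Inl 3" "Inr 2"]
      path[of "Inl 4" "Inl 3" "Inl 2" "Inr 3"] path[of "Inl 1" "Inr 2" "Inl 3" "Inl 4"]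
      path[of "Inl 1" "Inl 2" "Inr 3" "Inl 4"] path[of "Inr 2" "Inl 3" "Inl 2" "Inr 3"] assms(1)
    by simp_all
  have not_distinct: "\<not> distinct [a1, a2, b2, a4]" "\<not> distinct [a4, a3, b3, a1]"
    "\<not> distinct [a1, a2, a3, a4]" "\<not> distinct [a1, a2, a3, b2]" "\<not> distinct [a2, a3, a4, b3]"
    unfolding defs by (rule three; simp add: V)+
  \<comment> \<open>If \<open>a1 = a3\<close>, three of the paths force \<open>a2\<close>,
    \<open>b2\<close> and \<open>a4\<close> to be pairwise different, and properness separates all
    of them from \<open>a1\<close>: four colors. The claim \<open>a2 \<noteq> a4\<close> is the
    mirror image.\<close>
  have "a1 \<noteq> a3"
    using not_distinct(1) proper paths by auto
  moreover have "a2 \<noteq> a4"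
    using not_distinct(2) proper paths by auto
  \<comment> \<open>Each of these vertices has two neighbors of different colors, so only the third
    color is left for it, or, for \<open>a4\<close>, the vertices 2 and 3 rule out all but
    \<open>a1\<close>.\<close>
  ultimately have "a4 = a1" "b2 = a2" "b3 = a3"
    using not_distinct(3-5) proper by auto
  with paths show False
    by simp
qed

theorem theorem3:
  fixes n :: nat
  assumes "n \<ge> 4"
  shows "star_chromatic_number (splitting_graph (path_graph n)) = 4"
  unfolding star_chromatic_number_def
proof (rule Least_equality)
  have "card (splitting_path_coloring ` verts (splitting_graph (path_graph n))) = 4"
    using assms by (subst splitting_path_coloring_image) auto
  then show "\<exists>c. star_coloring (splitting_graph (path_graph n)) c \<and>
      card (c ` verts (splitting_graph (path_graph n))) = 4"
    using star_coloring_splitting_path by blast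
next
  fix k
  assume "\<exists>c. star_coloring (splitting_graph (path_graph n)) c \<and>
      card (c ` verts (splitting_graph (path_graph n))) = k"
  then show "4 \<le> k"
    using card_ge_4_if_star_coloring[OF assms] by auto
qed

end
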